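(* Let $S$ be a set and let $P$ be an algebra of $S$-probabilities which is a lattice with respect to the pointwise order of functions (with lattice operations $\vee,\wedge$ computed in $P$). Then $P$ is a Boolean algebra if and only if $p+q-2(p\wedge q)\le 1$ for all $p,q\in P$. Moreover, if this is the case, the addition of the Boolean ring corresponding to the Boolean algebra $P$ (with multiplication $p\wedge q$) is given by $p\,\widehat{+}\,q:=p+q-2(p\wedge q)$.
   Context: An $S$-probability is a function $p:S\to[0,1]$. Sets of $S$-probabilities are partially ordered by the pointwise order $\le$ of functions; $p+q$, $p-q$, $np$ denote the pointwise real-function operations, $p':=1-p$, and $p\perp q$ means $p\le q'$. An algebra of $S$-probabilities is a set $P$ of $S$-probabilities such that (A1) the constant functions $0,1$ belong to $P$; (A2) $p'\in P$ for every $p\in P$; (A3) if $p,q,r\in P$ with $p\perp q$, $q\perp r$, $r\perp p$, then $p+q+r\in P$. The Boolean ring corresponding to a Boolean algebra has multiplication $\wedge$ and addition the symmetric difference $(p\wedge q')\vee(p'\wedge q)$. *)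

theory Defs
  imports "HOL-Algebra.Lattice" "HOL-Algebra.Ring" "HOL-Library.FuncSet" Complex_Main
begin

locale boolean_lattice = bounded_lattice L for L (structure) +
  fixes compl :: "'a \<Rightarrow> 'a"
  assumes distrib:
      "\<lbrakk>x \<in> carrier L; y \<in> carrier L; z \<in> carrier L\<rbrakk>
        \<Longrightarrow> x \<sqinter> (y \<squnion> z) = (x \<sqinter> y) \<squnion> (x \<sqinter> z)"
    and compl_closed: "x \<in> carrier L \<Longrightarrow> compl x \<in> carrier L"
    and meet_compl: "x \<in> carrier L \<Longrightarrow> x \<sqinter> compl x = \<bottom>"
    and join_compl: "x \<in> carrier L \<Longrightarrow> x \<squnion> compl x = \<top>"

definition boolean_ring :: "('a, 'b) gorder_scheme \<Rightarrow> ('a \<Rightarrow> 'a) \<Rightarrow> 'a ring" where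
  "boolean_ring L compl =
    \<lparr>carrier = carrier L,
     mult = (\<lambda>x y. x \<sqinter>\<^bsub>L\<^esub> y),
     one = \<top>\<^bsub>L\<^esub>,
     zero = \<bottom>\<^bsub>L\<^esub>,
     add = (\<lambda>x y. (x \<sqinter>\<^bsub>L\<^esub> compl y) \<squnion>\<^bsub>L\<^esub> (compl x \<sqinter>\<^bsub>L\<^esub> y))\<rparr>"

text \<open>The next lemmas lead to \<open>boolean_ring_cring\<close> and \<open>boolean_ring_idem\<close>: for a Boolean
  lattice, the record \<^const>\<open>boolean_ring\<close> is indeed a commutative ring with idempotent
  multiplication.\<close>

context boolean_lattice
begin

lemma closeds:
  "\<lbrakk>x \<in> carrier L; y \<in> carrier L\<rbrakk> \<Longrightarrow> x \<sqinter> y \<in> carrier L"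
  "\<lbrakk>x \<in> carrier L; y \<in> carrier L\<rbrakk> \<Longrightarrow> x \<squnion> y \<in> carrier L"
  "x \<in> carrier L \<Longrightarrow> compl x \<in> carrier L"
  "\<bottom> \<in> carrier L" "\<top> \<in> carrier L"
  by (simp_all add: compl_closed)

lemma units:
  assumes "x \<in> carrier L"
  shows "\<bottom> \<sqinter> x = \<bottom>" "x \<sqinter> \<bottom> = \<bottom>" "\<bottom> \<squnion> x = x" "x \<squnion> \<bottom> = x"
    "\<top> \<sqinter> x = x" "x \<sqinter> \<top> = x" "x \<sqinter> x = x" "x \<squnion> x = x"
proof -
  show 1: "\<bottom> \<sqinter> x = \<bottom>"
    using le_iff_join[of "\<bottom>" x] assms by simp
  show 2: "\<bottom> \<squnion> x = x"
    using le_iff_meet[of "\<bottom>" x] assms by simp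
  show 3: "x \<sqinter> \<top> = x"
    using le_iff_join[of x "\<top>"] assms by simp
  show "x \<sqinter> \<bottom> = \<bottom>" "x \<squnion> \<bottom> = x" "\<top> \<sqinter> x = x"
    using 1 2 3 by (simp_all add: meet_comm[of L] join_comm[of L])
  show "x \<sqinter> x = x" using le_iff_join[of x x] assms by simp
  show "x \<squnion> x = x" using le_iff_meet[of x x] assms by simp
qed

lemma distrib_right:
  assumes "x \<in> carrier L" "y \<in> carrier L" "z \<in> carrier L"
  shows "(y \<squnion> z) \<sqinter> x = (y \<sqinter> x) \<squnion> (z \<sqinter> x)"
  using distrib[OF assms] by (simp add: meet_comm[of L])

lemma meet_lcomm:
  assumes "x \<in> carrier L" "y \<in> carrier L" "z \<in> carrier L"
  shows "x \<sqinter> (y \<sqinter> z) = y \<sqinter> (x \<sqinter> z)"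
  using assms by (metis meet_assoc meet_comm)

lemma join_lcomm:
  assumes "x \<in> carrier L" "y \<in> carrier L" "z \<in> carrier L"
  shows "x \<squnion> (y \<squnion> z) = y \<squnion> (x \<squnion> z)"
  using assms by (metis join_assoc join_comm)

lemmas meet_ac = meet_assoc meet_comm[of L] meet_lcomm
lemmas join_ac = join_assoc join_comm[of L] join_lcomm

lemma meet_compl_left:
  assumes "x \<in> carrier L" "y \<in> carrier L"
  shows "x \<sqinter> (compl x \<sqinter> y) = \<bottom>" "compl x \<sqinter> (x \<sqinter> y) = \<bottom>" "compl x \<sqinter> x = \<bottom>"
    "x \<sqinter> (x \<sqinter> y) = x \<sqinter> y" "x \<sqinter> (y \<sqinter> compl x) = \<bottom>" "compl x \<sqinter> (y \<sqinter> x) = \<bottom>"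
proof -
  show 1: "x \<sqinter> (compl x \<sqinter> y) = \<bottom>"
    using assms by (simp add: meet_assoc[symmetric] closeds meet_compl units)
  show 3: "compl x \<sqinter> x = \<bottom>"
    using assms by (simp add: meet_comm[of L "compl x" x] meet_compl)
  show 2: "compl x \<sqinter> (x \<sqinter> y) = \<bottom>"
    using assms by (simp add: meet_assoc[symmetric] closeds 3 units)
  show "x \<sqinter> (x \<sqinter> y) = x \<sqinter> y"
    using assms by (simp add: meet_assoc[symmetric] closeds units)
  show "x \<sqinter> (y \<sqinter> compl x) = \<bottom>"
    using 1 by (simp add: meet_comm[of L y])
  show "compl x \<sqinter> (y \<sqinter> x) = \<bottom>"
    using 2 by (simp add: meet_comm[of L y])
qed

lemma compl_unique:
  assumes x: "x \<in> carrier L" and y: "y \<in> carrier L"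
    and m: "x \<sqinter> y = \<bottom>" and j: "x \<squnion> y = \<top>"
  shows "compl x = y"
proof -
  have "compl x = compl x \<sqinter> (x \<squnion> y)"
    using x by (simp add: j units closeds)
  also have "\<dots> = compl x \<sqinter> y"
    using x y by (simp add: distrib closeds meet_compl_left[OF x y] units)
  also have "\<dots> = y \<sqinter> (x \<squnion> compl x)"
    using x y m
    by (simp add: distrib closeds meet_comm[of L y x] meet_comm[of L y "compl x"] units)
  also have "\<dots> = y"
    using x y by (simp add: join_compl units)
  finally show ?thesis .
qed

lemma minterms:
  assumes x: "x \<in> carrier L" and y: "y \<in> carrier L"
  shows "((x \<sqinter> y) \<squnion> (x \<sqinter> compl y)) \<squnion> ((compl x \<sqinter> y) \<squnion> (compl x \<sqinter> compl y)) = \<top>"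
  using x y by (simp add: distrib[symmetric] closeds join_compl units)

lemma split_meet:
  assumes x: "x \<in> carrier L" and y: "y \<in> carrier L"
  shows "(x \<sqinter> y) \<squnion> (x \<sqinter> compl y) = x"
  using x y by (simp add: distrib[symmetric] closeds join_compl units)

lemma compl_meet:
  assumes x: "x \<in> carrier L" and y: "y \<in> carrier L"
  shows "compl (x \<sqinter> y) = compl x \<squnion> compl y"
proof (rule compl_unique)
  show "x \<sqinter> y \<sqinter> (compl x \<squnion> compl y) = \<bottom>"
    using x y by (simp add: distrib closeds meet_assoc meet_compl meet_compl_left units)
  have "compl x \<squnion> compl y = compl x \<squnion> ((compl y \<sqinter> x) \<squnion> (compl y \<sqinter> compl x))"
    using x y by (simp add: split_meet closeds)
  also have "\<dots> = (x \<sqinter> compl y) \<squnion> (compl x \<squnion> (compl x \<sqinter> compl y))"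
    using x y by (simp add: join_ac closeds meet_comm[of L "compl y"])
  also have "compl x \<squnion> (compl x \<sqinter> compl y) = compl x"
    using x y le_iff_meet[of "compl x \<sqinter> compl y" "compl x"]
    by (simp add: closeds meet_left join_comm[of L "compl x"])
  finally have e: "compl x \<squnion> compl y = (x \<sqinter> compl y) \<squnion> compl x" .
  have "(x \<sqinter> y) \<squnion> (compl x \<squnion> compl y) = ((x \<sqinter> y) \<squnion> (x \<sqinter> compl y)) \<squnion> compl x"
    unfolding e using x y by (simp add: join_assoc closeds)
  then show "x \<sqinter> y \<squnion> (compl x \<squnion> compl y) = \<top>"
    using x y by (simp add: split_meet join_compl)
qed (use x y in \<open>simp_all add: closeds\<close>)

lemma compl_symdiff:
  assumes x: "x \<in> carrier L" and y: "y \<in> carrier L"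
  shows "compl ((x \<sqinter> compl y) \<squnion> (compl x \<sqinter> y)) = (x \<sqinter> y) \<squnion> (compl x \<sqinter> compl y)"
proof (rule compl_unique)
  have "x \<sqinter> compl y \<sqinter> (x \<sqinter> y) = \<bottom>" "x \<sqinter> compl y \<sqinter> (compl x \<sqinter> compl y) = \<bottom>"
    "compl x \<sqinter> y \<sqinter> (x \<sqinter> y) = \<bottom>" "compl x \<sqinter> y \<sqinter> (compl x \<sqinter> compl y) = \<bottom>"
    using x y by (simp_all add: closeds meet_assoc meet_compl meet_compl_left units
        meet_lcomm[of "compl y" "compl x"] meet_lcomm[of y x])
  then show "(x \<sqinter> compl y \<squnion> compl x \<sqinter> y) \<sqinter> (x \<sqinter> y \<squnion> compl x \<sqinter> compl y) = \<bottom>"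
    using x y by (simp add: distrib distrib_right closeds units)
  show "x \<sqinter> compl y \<squnion> compl x \<sqinter> y \<squnion> (x \<sqinter> y \<squnion> compl x \<sqinter> compl y) = \<top>"
    using minterms[OF x y] x y by (simp add: closeds join_ac)
qed (use x y in \<open>simp_all add: closeds\<close>)

lemma symdiff_assoc:
  assumes x: "x \<in> carrier L" and y: "y \<in> carrier L" and z: "z \<in> carrier L"
  defines "sd \<equiv> \<lambda>x y. (x \<sqinter> compl y) \<squnion> (compl x \<sqinter> y)"
  shows "sd (sd x y) z = sd x (sd y z)"
  unfolding sd_def compl_symdiff[OF x y] compl_symdiff[OF y z] using x y z
  by (simp add: distrib distrib_right closeds meet_assoc join_ac)

lemma boolean_ring_cring: "cring (boolean_ring L compl)"
proof (rule cringI)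
  show "abelian_group (boolean_ring L compl)"
  proof (rule abelian_groupI)
    fix x assume "x \<in> carrier (boolean_ring L compl)"
    then show "\<exists>y\<in>carrier (boolean_ring L compl). y \<oplus>\<^bsub>boolean_ring L compl\<^esub> x = \<zero>\<^bsub>boolean_ring L compl\<^esub>"
      by (intro bexI[of _ x])
        (simp_all add: boolean_ring_def meet_compl meet_compl_left units closeds)
  next
    fix x assume "x \<in> carrier (boolean_ring L compl)"
    then show "\<zero>\<^bsub>boolean_ring L compl\<^esub> \<oplus>\<^bsub>boolean_ring L compl\<^esub> x = x"
      using compl_unique[of "\<bottom>" "\<top>"] by (simp add: boolean_ring_def units closeds)
  qed (simp_all add: boolean_ring_def closeds symdiff_assoc,
       simp add: meet_comm[of L] join_comm[of L])
  show "comm_monoid (boolean_ring L compl)"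
    by unfold_locales (auto simp: boolean_ring_def closeds units meet_assoc intro: meet_comm)
  fix x y z
  assume "x \<in> carrier (boolean_ring L compl)" "y \<in> carrier (boolean_ring L compl)"
    "z \<in> carrier (boolean_ring L compl)"
  then have xyz: "x \<in> carrier L" "y \<in> carrier L" "z \<in> carrier L"
    by (simp_all add: boolean_ring_def)
  have "x \<sqinter> z \<sqinter> compl (y \<sqinter> z) = x \<sqinter> compl y \<sqinter> z"
    "compl (x \<sqinter> z) \<sqinter> (y \<sqinter> z) = compl x \<sqinter> y \<sqinter> z"
    using xyz by (simp_all add: compl_meet distrib distrib_right closeds meet_assoc meet_compl
        meet_compl_left units meet_comm[of L z])
  then show "(x \<oplus>\<^bsub>boolean_ring L compl\<^esub> y) \<otimes>\<^bsub>boolean_ring L compl\<^esub> z =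
    x \<otimes>\<^bsub>boolean_ring L compl\<^esub> z \<oplus>\<^bsub>boolean_ring L compl\<^esub> y \<otimes>\<^bsub>boolean_ring L compl\<^esub> z"
    using xyz by (simp add: boolean_ring_def distrib_right closeds)
qed

lemma boolean_ring_idem:
  "x \<in> carrier (boolean_ring L compl) \<Longrightarrow> x \<otimes>\<^bsub>boolean_ring L compl\<^esub> x = x"
  by (simp add: boolean_ring_def units)

end

text \<open>Functions on the set \<open>S\<close> are represented by extensional functions, with value
  \<^const>\<open>undefined\<close> outside \<open>S\<close>, so that equality of functions is equality on \<open>S\<close>.\<close>

definition sprobs :: "'s set \<Rightarrow> ('s \<Rightarrow> real) set" where
  "sprobs S = S \<rightarrow>\<^sub>E {0..1}"

definition sp_le :: "'s set \<Rightarrow> ('s \<Rightarrow> real) \<Rightarrow> ('s \<Rightarrow> real) \<Rightarrow> bool" where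
  "sp_le S p q \<longleftrightarrow> (\<forall>s\<in>S. p s \<le> q s)"

definition sp_compl :: "'s set \<Rightarrow> ('s \<Rightarrow> real) \<Rightarrow> 's \<Rightarrow> real" where
  "sp_compl S p = (\<lambda>s\<in>S. 1 - p s)"

definition sp_orth :: "'s set \<Rightarrow> ('s \<Rightarrow> real) \<Rightarrow> ('s \<Rightarrow> real) \<Rightarrow> bool" where
  "sp_orth S p q \<longleftrightarrow> sp_le S p (sp_compl S q)"

definition sprob_algebra :: "'s set \<Rightarrow> ('s \<Rightarrow> real) set \<Rightarrow> bool" where
  "sprob_algebra S P \<longleftrightarrow>
    P \<subseteq> sprobs S \<and>
    (\<lambda>s\<in>S. 0) \<in> P \<and> (\<lambda>s\<in>S. 1) \<in> P \<and>
    (\<forall>p\<in>P. sp_compl S p \<in> P) \<and>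
    (\<forall>p\<in>P. \<forall>q\<in>P. \<forall>r\<in>P. sp_orth S p q \<and> sp_orth S q r \<and> sp_orth S r p
      \<longrightarrow> (\<lambda>s\<in>S. p s + q s + r s) \<in> P)"

definition sp_poset :: "'s set \<Rightarrow> ('s \<Rightarrow> real) set \<Rightarrow> ('s \<Rightarrow> real) gorder" where
  "sp_poset S P = \<lparr>carrier = P, eq = (=), le = sp_le S\<rparr>"

definition sp_hat_plus ::
  "'s set \<Rightarrow> ('s \<Rightarrow> real) set \<Rightarrow> ('s \<Rightarrow> real) \<Rightarrow> ('s \<Rightarrow> real) \<Rightarrow> 's \<Rightarrow> real" where
  "sp_hat_plus S P p q = (\<lambda>s\<in>S. p s + q s - 2 * (p \<sqinter>\<^bsub>sp_poset S P\<^esub> q) s)"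

end

theory Submission
  imports Defs
begin

text \<open>By (A3), the sum of two orthogonal elements of \<open>P\<close> is their join: if \<open>p \<perp> q\<close> and
  \<open>p, q \<le> r\<close>, then \<open>p, q, r'\<close> are pairwise orthogonal, so \<open>p + q + r' \<le> 1\<close>. Both the Boolean
  property and the inequality \<open>p + q - 2(p \<and> q) \<le> 1\<close> then amount to the decomposition
  \<open>p = (p \<and> q) + (p \<and> q')\<close>. For the inequality this holds because it makes \<open>p - p \<and> q\<close>,
  \<open>q - p \<and> q\<close> and \<open>p \<and> q\<close> pairwise orthogonal, so that their sum \<open>p + q - p \<and> q\<close> is at most \<open>1\<close>,
  i.e. \<open>p - p \<and> q \<le> q'\<close>. The decomposition shows that \<open>p \<and> q = 0\<close> forces \<open>p \<le> q'\<close>, which yields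
  distributivity.\<close>

locale sprob_lattice =
  fixes S :: "'s set" and P :: "('s \<Rightarrow> real) set"
  assumes algebra: "sprob_algebra S P"
    and lattice_poset: "lattice (sp_poset S P)"

text \<open>The rewriting makes the inherited lattice facts speak of \<open>P\<close> and
  \<open>sp_le S\<close>, so that they apply without unfolding \<open>sp_poset\<close>.\<close>

sublocale sprob_lattice \<subseteq> lattice "sp_poset S P"
  rewrites carrier_poset: "carrier (sp_poset S P) = P"
    and le_poset: "x \<sqsubseteq>\<^bsub>sp_poset S P\<^esub> y \<longleftrightarrow> sp_le S x y"
  using lattice_poset by (simp_all add: sp_poset_def)

lemma sp_compl_apply: "s \<in> S \<Longrightarrow> sp_compl S p s = 1 - p s"
  by (simp add: sp_compl_def)

context sprob_lattice
begin

abbreviation meet_P (infixl "\<sqinter>\<^sub>P" 70) where "p \<sqinter>\<^sub>P q \<equiv> p \<sqinter>\<^bsub>sp_poset S P\<^esub> q"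
abbreviation join_P (infixl "\<squnion>\<^sub>P" 65) where "p \<squnion>\<^sub>P q \<equiv> p \<squnion>\<^bsub>sp_poset S P\<^esub> q"

section \<open>Membership in \<open>P\<close> and orthogonal sums\<close>

lemma range:
  assumes "p \<in> P" "s \<in> S"
  shows "0 \<le> p s" "p s \<le> 1"
  using algebra assms by (auto simp: sprob_algebra_def sprobs_def PiE_def Pi_def subset_iff)

lemma eqI:
  assumes "p \<in> P" "q \<in> P" "\<And>s. s \<in> S \<Longrightarrow> p s = q s"
  shows "p = q"
proof (rule PiE_ext)
  show "p \<in> S \<rightarrow>\<^sub>E {0..1}" "q \<in> S \<rightarrow>\<^sub>E {0..1}"
    using algebra assms(1,2) by (auto simp: sprob_algebra_def sprobs_def)
qed (use assms in auto)

lemma zero_in: "(\<lambda>s\<in>S. 0) \<in> P"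
  and one_in: "(\<lambda>s\<in>S. 1) \<in> P"
  and compl_in: "p \<in> P \<Longrightarrow> sp_compl S p \<in> P"
  using algebra by (auto simp: sprob_algebra_def)

lemma sum3_in:
  assumes "p \<in> P" "q \<in> P" "r \<in> P"
    and "\<And>s. s \<in> S \<Longrightarrow> p s + q s \<le> 1"
    and "\<And>s. s \<in> S \<Longrightarrow> q s + r s \<le> 1"
    and "\<And>s. s \<in> S \<Longrightarrow> r s + p s \<le> 1"
  shows "(\<lambda>s\<in>S. p s + q s + r s) \<in> P"
proof -
  have "sp_orth S p q \<and> sp_orth S q r \<and> sp_orth S r p"
    using assms(4-6) by (simp add: sp_orth_def sp_le_def sp_compl_apply le_diff_eq)
  then show ?thesis
    using algebra assms(1-3) unfolding sprob_algebra_def by blast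
qed

lemma sum_in:
  assumes "p \<in> P" "q \<in> P" "\<And>s. s \<in> S \<Longrightarrow> p s + q s \<le> 1"
  shows "(\<lambda>s\<in>S. p s + q s) \<in> P"
proof -
  \<comment> \<open>(A3) with the constant 0 as third summand.\<close>
  have "(\<lambda>s\<in>S. p s + q s + (\<lambda>s\<in>S. 0) s) \<in> P"
    by (rule sum3_in) (use assms zero_in range in \<open>auto simp: restrict_apply' simp del: restrict_apply\<close>)
  then show ?thesis
    by (rule back_subst[where P = "\<lambda>f. f \<in> P"]) auto
qed

text \<open>The difference is the complement of \<open>p + q'\<close>, a sum that is orthogonal
  because \<open>p\<close> lies below \<open>q\<close>.\<close>

lemma diff_in:
  assumes "p \<in> P" "q \<in> P" "sp_le S p q"
  shows "(\<lambda>s\<in>S. q s - p s) \<in> P"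
proof -
  have "(\<lambda>s\<in>S. p s + sp_compl S q s) \<in> P"
    by (rule sum_in) (use assms compl_in in \<open>auto simp: sp_compl_apply sp_le_def\<close>)
  from compl_in[OF this] show ?thesis
    by (rule back_subst[where P = "\<lambda>f. f \<in> P"]) (auto simp: sp_compl_def)
qed

lemma orthogonal_sum_le:
  assumes "p \<in> P" "q \<in> P" "r \<in> P" "s \<in> S"
    and "\<And>s. s \<in> S \<Longrightarrow> p s + q s \<le> 1"
    and "sp_le S p r" "sp_le S q r"
  shows "p s + q s \<le> r s"
proof -
  have "(\<lambda>s\<in>S. p s + q s + sp_compl S r s) \<in> P"
    by (rule sum3_in) (use assms compl_in in \<open>auto simp: sp_compl_apply sp_le_def\<close>)
  from range(2)[OF this \<open>s \<in> S\<close>] show ?thesis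
    using \<open>s \<in> S\<close> by (simp add: sp_compl_apply)
qed

lemma join_orthogonal:
  assumes "p \<in> P" "q \<in> P" "\<And>s. s \<in> S \<Longrightarrow> p s + q s \<le> 1"
  shows "p \<squnion>\<^sub>P q = (\<lambda>s\<in>S. p s + q s)"
proof (rule le_antisym)
  show "sp_le S (p \<squnion>\<^sub>P q) (\<lambda>s\<in>S. p s + q s)"
    by (rule join_le) (use assms sum_in range in \<open>auto simp: sp_le_def\<close>)
  show "sp_le S (\<lambda>s\<in>S. p s + q s) (p \<squnion>\<^sub>P q)"
    using orthogonal_sum_le[of p q "p \<squnion>\<^sub>P q"] assms join_left join_right
    by (simp add: sp_le_def)
qed (use assms sum_in in auto)

section \<open>Complements\<close>

lemma join_compl: "p \<in> P \<Longrightarrow> p \<squnion>\<^sub>P sp_compl S p = (\<lambda>s\<in>S. 1)"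
  by (subst join_orthogonal) (auto simp: compl_in sp_compl_apply)

text \<open>Taking complements puts both \<open>p\<close> and \<open>p'\<close> below
  \<open>r'\<close>, so their orthogonal sum, which is 1, is below \<open>r'\<close>.\<close>

lemma below_compl_self:
  assumes "p \<in> P" "r \<in> P" "sp_le S r p" "sp_le S r (sp_compl S p)"
  shows "r = (\<lambda>s\<in>S. 0)"
proof (rule eqI)
  fix s assume s: "s \<in> S"
  have "p s + sp_compl S p s \<le> sp_compl S r s"
    by (rule orthogonal_sum_le) (use assms s compl_in in \<open>auto simp: sp_compl_apply sp_le_def\<close>)
  then show "r s = (\<lambda>s\<in>S. 0) s"
    using s range[OF assms(2) s] by (simp add: sp_compl_apply)
qed (use assms zero_in in auto)

lemma meet_compl: "p \<in> P \<Longrightarrow> p \<sqinter>\<^sub>P sp_compl S p = (\<lambda>s\<in>S. 0)"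
  by (rule below_compl_self) (auto intro: meet_left meet_right simp: compl_in)

section \<open>Decomposition along an element and its complement\<close>

lemma meet_compl_orthogonal:
  assumes "p \<in> P" "q \<in> P" "s \<in> S"
  shows "(p \<sqinter>\<^sub>P q) s + (p \<sqinter>\<^sub>P sp_compl S q) s \<le> 1"
  using meet_right[of p q] meet_right[of p "sp_compl S q"] assms compl_in
  by (force simp: sp_le_def sp_compl_apply)

text \<open>The hub of the proof: the Boolean property and the bound are each shown equivalent to
  it. In the language of orthomodular lattices, any two elements of \<open>P\<close>
  commute.\<close>

definition decomposes where
  "decomposes \<longleftrightarrow> (\<forall>p\<in>P. \<forall>q\<in>P. \<forall>s\<in>S. p s = (p \<sqinter>\<^sub>P q) s + (p \<sqinter>\<^sub>P sp_compl S q) s)"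

lemma boolean_imp_decomposes:
  assumes "boolean_lattice (sp_poset S P) (sp_compl S)"
  shows decomposes
proof -
  interpret B: boolean_lattice "sp_poset S P" "sp_compl S" by fact
  show ?thesis
    unfolding decomposes_def
  proof (intro ballI)
    fix p q s assume pq: "p \<in> P" "q \<in> P" and s: "s \<in> S"
    have "p = (p \<sqinter>\<^sub>P q) \<squnion>\<^sub>P (p \<sqinter>\<^sub>P sp_compl S q)"
      using B.split_meet[of p q] pq by (simp add: carrier_poset)
    also have "\<dots> = (\<lambda>s\<in>S. (p \<sqinter>\<^sub>P q) s + (p \<sqinter>\<^sub>P sp_compl S q) s)"
      by (rule join_orthogonal) (use pq compl_in meet_compl_orthogonal in auto)
    finally have "p s = (\<lambda>s\<in>S. (p \<sqinter>\<^sub>P q) s + (p \<sqinter>\<^sub>P sp_compl S q) s) s"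
      by (rule fun_cong)
    then show "p s = (p \<sqinter>\<^sub>P q) s + (p \<sqinter>\<^sub>P sp_compl S q) s"
      using s by simp
  qed
qed

lemma bound_imp_decomposes:
  assumes bound: "\<And>p q. p \<in> P \<Longrightarrow> q \<in> P \<Longrightarrow> sp_le S (sp_hat_plus S P p q) (\<lambda>s\<in>S. 1)"
  shows decomposes
  unfolding decomposes_def
proof (intro ballI)
  fix p q s assume pq: "p \<in> P" "q \<in> P" and s: "s \<in> S"
  let ?c = "p \<sqinter>\<^sub>P q" and ?d = "p \<sqinter>\<^sub>P sp_compl S q"
  let ?a = "\<lambda>s\<in>S. p s - ?c s" and ?b = "\<lambda>s\<in>S. q s - ?c s"
  have c: "?c \<in> P" "sp_le S ?c p" "sp_le S ?c q"
    and d: "?d \<in> P" "sp_le S ?d p"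
    using pq compl_in by (auto intro: meet_left meet_right)
  have a: "?a \<in> P" and b: "?b \<in> P"
    using pq c diff_in by auto
  \<comment> \<open>Orthogonality of \<open>?a\<close> and \<open>?b\<close> is exactly the assumed
    bound; the other two pairs add up to \<open>q\<close> and \<open>p\<close>.\<close>
  have "(\<lambda>s\<in>S. ?a s + ?b s + ?c s) \<in> P"
    by (rule sum3_in)
      (use a b c pq bound[OF pq] range in
        \<open>auto simp: sp_le_def sp_hat_plus_def restrict_apply' simp del: restrict_apply\<close>)
  from range(2)[OF this] have "sp_le S ?a (sp_compl S q)"
    by (fastforce simp: sp_le_def sp_compl_apply)
  moreover have "sp_le S ?a p"
    using c range by (simp add: sp_le_def)
  ultimately have "sp_le S ?a ?d"
    using a pq compl_in by (intro meet_le)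
  then have "p s \<le> ?c s + ?d s"
    using s by (auto simp: sp_le_def)
  \<comment> \<open>Conversely, \<open>?c\<close> and \<open>?d\<close> are orthogonal and both lie
    below \<open>p\<close>.\<close>
  moreover have "?c s + ?d s \<le> p s"
    by (rule orthogonal_sum_le) (use c d pq s meet_compl_orthogonal in auto)
  ultimately show "p s = ?c s + ?d s" by simp
qed

text \<open>Decomposing \<open>p\<close> along \<open>q\<close> and \<open>q\<close> along
  \<open>p\<close> and adding, the common meet occurs twice and cancels. The two remaining meets lie
  below \<open>p\<close> and \<open>p'\<close>, so their sum is their join.\<close>

lemma sp_hat_plus_eq:
  assumes decomposes and pq: "p \<in> P" "q \<in> P"
  shows "sp_hat_plus S P p q = (p \<sqinter>\<^sub>P sp_compl S q) \<squnion>\<^sub>P (sp_compl S p \<sqinter>\<^sub>P q)"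
proof -
  let ?a = "p \<sqinter>\<^sub>P sp_compl S q" and ?b = "sp_compl S p \<sqinter>\<^sub>P q"
  have "?a \<squnion>\<^sub>P ?b = (\<lambda>s\<in>S. ?a s + ?b s)"
    using meet_left[of p "sp_compl S q"] meet_left[of "sp_compl S p" q] pq compl_in
    by (intro join_orthogonal) (force simp: sp_le_def sp_compl_apply)+
  moreover have "p s + q s - 2 * (p \<sqinter>\<^sub>P q) s = ?a s + ?b s" if "s \<in> S" for s
  proof -
    have "p s = (p \<sqinter>\<^sub>P q) s + ?a s" "q s = (q \<sqinter>\<^sub>P p) s + (q \<sqinter>\<^sub>P sp_compl S p) s"
      using assms that unfolding decomposes_def by blast+
    then show ?thesis
      by (simp add: meet_comm[of "sp_poset S P" q])
  qed
  ultimately show ?thesis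
    by (auto simp: sp_hat_plus_def)
qed

section \<open>Distributivity\<close>

lemma decomposes_imp_le_compl:
  assumes decomposes and pq: "p \<in> P" "q \<in> P" and "p \<sqinter>\<^sub>P q = (\<lambda>s\<in>S. 0)"
  shows "sp_le S p (sp_compl S q)"
proof -
  have "sp_le S p (p \<sqinter>\<^sub>P sp_compl S q)"
    using assms unfolding decomposes_def sp_le_def by fastforce
  moreover have "sp_le S (p \<sqinter>\<^sub>P sp_compl S q) (sp_compl S q)"
    using pq compl_in by (intro meet_right)
  ultimately show ?thesis
    by (force simp: sp_le_def)
qed

text \<open>For the nontrivial inequality, let \<open>?f\<close> be the part of the left side
  outside the right side. It lies below the join of \<open>y\<close> and \<open>z\<close>, but also
  below the complement of that join, and hence vanishes.\<close>

lemma decomposes_imp_distrib: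
  assumes decomposes and xyz: "x \<in> P" "y \<in> P" "z \<in> P"
  shows "x \<sqinter>\<^sub>P (y \<squnion>\<^sub>P z) = (x \<sqinter>\<^sub>P y) \<squnion>\<^sub>P (x \<sqinter>\<^sub>P z)" (is "?e = ?d")
proof (rule le_antisym)
  let ?f = "?e \<sqinter>\<^sub>P sp_compl S ?d"
  have mem: "?e \<in> P" "?d \<in> P" "?f \<in> P"
    using xyz compl_in by auto
  have fe: "sp_le S ?f ?e" and fd: "sp_le S ?f (sp_compl S ?d)"
    using mem compl_in by (auto intro: meet_left meet_right)
  have fx: "sp_le S ?f x" and fyz: "sp_le S ?f (y \<squnion>\<^sub>P z)"
    using fe meet_left[of x "y \<squnion>\<^sub>P z"] meet_right[of x "y \<squnion>\<^sub>P z"] xyz mem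
    by (auto intro: le_trans)
  \<comment> \<open>Used for \<open>w\<close> equal to \<open>y\<close> and to \<open>z\<close>.
    Since \<open>?f\<close> is below \<open>x\<close>, its meet with \<open>w\<close> lies below
    \<open>?d\<close>; it also lies below the complement of \<open>?d\<close>, so it is 0.\<close>
  have f_compl: "sp_le S ?f (sp_compl S w)"
    if w: "w \<in> P" and wd: "sp_le S (x \<sqinter>\<^sub>P w) ?d" for w
  proof (rule decomposes_imp_le_compl)
    have fw: "?f \<sqinter>\<^sub>P w \<in> P" "sp_le S (?f \<sqinter>\<^sub>P w) ?f" "sp_le S (?f \<sqinter>\<^sub>P w) w"
      using mem w by (auto intro: meet_left meet_right)
    have "sp_le S (?f \<sqinter>\<^sub>P w) (x \<sqinter>\<^sub>P w)"
      using fw fx xyz w mem by (intro meet_le) (auto intro: le_trans)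
    then have "sp_le S (?f \<sqinter>\<^sub>P w) ?d"
      using wd by (force simp: sp_le_def)
    moreover have "sp_le S (?f \<sqinter>\<^sub>P w) (sp_compl S ?d)"
      using fw fd by (force simp: sp_le_def)
    ultimately show "?f \<sqinter>\<^sub>P w = (\<lambda>s\<in>S. 0)"
      using below_compl_self mem fw by blast
  qed (use assms mem w in auto)
  have "sp_le S ?f (sp_compl S y)" "sp_le S ?f (sp_compl S z)"
    using xyz by (auto intro!: f_compl join_left join_right)
  \<comment> \<open>Complementation reverses the order, which replaces a De Morgan law for the
    join.\<close>
  then have "sp_le S y (sp_compl S ?f)" "sp_le S z (sp_compl S ?f)"
    by (force simp: sp_le_def sp_compl_apply)+
  then have "sp_le S (y \<squnion>\<^sub>P z) (sp_compl S ?f)"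
    using xyz mem compl_in by (intro join_le)
  then have "sp_le S ?f (sp_compl S (y \<squnion>\<^sub>P z))"
    by (force simp: sp_le_def sp_compl_apply)
  then have "?f = (\<lambda>s\<in>S. 0)"
    using below_compl_self[OF _ _ fyz] xyz mem by simp
  \<comment> \<open>A vanishing meet with \<open>?d'\<close> puts \<open>?e\<close> below
    \<open>?d''\<close>, which agrees with \<open>?d\<close> on \<open>S\<close>.\<close>
  then have "sp_le S ?e (sp_compl S (sp_compl S ?d))"
    using decomposes_imp_le_compl assms(1) mem compl_in by blast
  then show "sp_le S ?e ?d"
    by (simp add: sp_le_def sp_compl_apply)
  show "sp_le S ?d ?e"
  proof (intro join_le meet_le)
    show "sp_le S (x \<sqinter>\<^sub>P y) x" "sp_le S (x \<sqinter>\<^sub>P z) x"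
      using xyz by (auto intro: meet_left)
    show "sp_le S (x \<sqinter>\<^sub>P y) (y \<squnion>\<^sub>P z)"
      using meet_right[OF xyz(1,2)] join_left[OF xyz(2,3)] by (force simp: sp_le_def)
    show "sp_le S (x \<sqinter>\<^sub>P z) (y \<squnion>\<^sub>P z)"
      using meet_right[OF xyz(1,3)] join_right[OF xyz(2,3)] by (force simp: sp_le_def)
  qed (use xyz in auto)
qed (use xyz in auto)

lemma decomposes_imp_boolean:
  assumes decomposes
  shows "boolean_lattice (sp_poset S P) (sp_compl S)"
proof -
  have "least (sp_poset S P) (\<lambda>s\<in>S. 0) P" "greatest (sp_poset S P) (\<lambda>s\<in>S. 1) P"
    using zero_in one_in range
    by (auto simp: least_def greatest_def sp_poset_def sp_le_def)
  then interpret bounded_lattice "sp_poset S P"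
    by unfold_locales (auto simp: carrier_poset)
  \<comment> \<open>The complement laws were proved for the constant functions, so the abstract
    bounds have to be identified with these.\<close>
  have "\<bottom>\<^bsub>sp_poset S P\<^esub> = (\<lambda>s\<in>S. 0)" "\<top>\<^bsub>sp_poset S P\<^esub> = (\<lambda>s\<in>S. 1)"
    using zero_in one_in range
    by (auto intro!: bottom_eq[symmetric] top_eq[symmetric] simp: carrier_poset le_poset sp_le_def)
  then show ?thesis
    using assms by unfold_locales
      (auto simp: carrier_poset compl_in meet_compl join_compl decomposes_imp_distrib)
qed

section \<open>The equivalences\<close>

lemma boolean_iff_decomposes:
  "boolean_lattice (sp_poset S P) (sp_compl S) \<longleftrightarrow> decomposes"
  using boolean_imp_decomposes decomposes_imp_boolean by blast

lemma decomposes_iff_bound: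
  "decomposes \<longleftrightarrow> (\<forall>p\<in>P. \<forall>q\<in>P. sp_le S (sp_hat_plus S P p q) (\<lambda>s\<in>S. 1))"
proof
  assume decomposes
  show "\<forall>p\<in>P. \<forall>q\<in>P. sp_le S (sp_hat_plus S P p q) (\<lambda>s\<in>S. 1)"
  proof (intro ballI)
    fix p q assume pq: "p \<in> P" "q \<in> P"
    \<comment> \<open>As a join of two elements of \<open>P\<close> it is an
      \<open>S\<close>-probability, which gives the bound.\<close>
    then have "sp_hat_plus S P p q \<in> P"
      using sp_hat_plus_eq[OF \<open>decomposes\<close>] compl_in by simp
    then show "sp_le S (sp_hat_plus S P p q) (\<lambda>s\<in>S. 1)"
      using range(2) by (simp add: sp_le_def)
  qed
qed (use bound_imp_decomposes in blast)

end

theorem theorem1p2: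
  fixes S :: "'s set" and P :: "('s \<Rightarrow> real) set"
  assumes "sprob_algebra S P"
    and "lattice (sp_poset S P)"
  shows "(boolean_lattice (sp_poset S P) (sp_compl S) \<longleftrightarrow>
            (\<forall>p\<in>P. \<forall>q\<in>P. sp_le S (sp_hat_plus S P p q) (\<lambda>s\<in>S. 1))) \<and>
         (boolean_lattice (sp_poset S P) (sp_compl S) \<longrightarrow>
            (\<forall>p\<in>P. \<forall>q\<in>P.
              p \<oplus>\<^bsub>boolean_ring (sp_poset S P) (sp_compl S)\<^esub> q = sp_hat_plus S P p q))"
proof -
  interpret sprob_lattice S P
    using assms by (intro sprob_lattice.intro)
  show ?thesis
    \<comment> \<open>The ring addition unfolds to the right-hand side of
      \<open>sp_hat_plus_eq\<close>.\<close>
    using boolean_iff_decomposes decomposes_iff_bound sp_hat_plus_eq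
    by (simp add: boolean_ring_def)
qed

end
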